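(* Let $G$ be a graph with $n$ vertices and $m$ edges. The algorithm SPARSE$_3(G)$ described below returns a $3$-path vertex cover $H$ of $G$ with $|H|\le \frac{2n+m}{6}$.
   Context: Graphs are finite and simple. A subset $S\subseteq V(G)$ is a $3$-path vertex cover of $G$ if every path on $3$ vertices in $G$ contains at least one vertex of $S$. Algorithm SPARSE$_3(G)$: set $H:=\emptyset$; while the current graph $G$ contains a vertex $v$ of degree at least $4$, add $v$ to $H$ and remove from $G$ the vertex $v$ and all edges incident with $v$; then (the remaining graph $G'$ having maximum degree at most $3$) add to $H$ a $3$-path vertex cover of $G'$ of size at most $\min\left(\frac{|V(G')|}{2},\frac{|E(G')|}{2}\right)$, computed by a linear time procedure for graphs of maximum degree at most $3$; return $H$. *)

theory Defs
  imports Complex_Main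
begin

definition simple_graph :: "'a set \<Rightarrow> 'a set set \<Rightarrow> bool" where
  "simple_graph V E \<longleftrightarrow> finite V \<and> (\<forall>e\<in>E. e \<subseteq> V \<and> card e = 2)"

definition degree :: "'a set set \<Rightarrow> 'a \<Rightarrow> nat" where
  "degree E v = card {e \<in> E. v \<in> e}"

text \<open>A path is given by the list of its vertices; it is a subgraph, not
  necessarily an induced one.\<close>

definition is_path :: "'a set \<Rightarrow> 'a set set \<Rightarrow> 'a list \<Rightarrow> bool" where
  "is_path V E p \<longleftrightarrow> distinct p \<and> set p \<subseteq> V \<and>
     (\<forall>i. Suc i < length p \<longrightarrow> {p ! i, p ! Suc i} \<in> E)"

definition three_path_vertex_cover :: "'a set \<Rightarrow> 'a set set \<Rightarrow> 'a set \<Rightarrow> bool" where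
  "three_path_vertex_cover V E S \<longleftrightarrow> S \<subseteq> V \<and>
     (\<forall>p. is_path V E p \<and> length p = 3 \<longrightarrow> set p \<inter> S \<noteq> {})"

text \<open>The algorithm is a nondeterministic transition system: neither the choice of the
  vertex of degree at least 4 nor the procedure for graphs of maximum degree at most 3 is
  fixed beyond its specification. A state \<open>Loop V E H\<close> holds the current graph
  \<open>(V, E)\<close> and the vertices collected so far; \<open>Returned H\<close> is a halted run with
  output \<open>H\<close>. If no set met the specification of the final step, a run would get
  stuck in a \<open>Loop\<close> state without returning.\<close>

datatype 'a sparse3_state = Loop "'a set" "'a set set" "'a set" | Returned "'a set"

inductive sparse3_step :: "'a sparse3_state \<Rightarrow> 'a sparse3_state \<Rightarrow> bool" where
  remove:
    "\<lbrakk>v \<in> V; degree E v \<ge> 4\<rbrakk> \<Longrightarrow>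
     sparse3_step (Loop V E H) (Loop (V - {v}) {e \<in> E. v \<notin> e} (insert v H))"
| finish:
    "\<lbrakk>\<forall>v\<in>V. degree E v \<le> 3;
      three_path_vertex_cover V E S;
      real (card S) \<le> min (real (card V) / 2) (real (card E) / 2)\<rbrakk> \<Longrightarrow>
     sparse3_step (Loop V E H) (Returned (H \<union> S))"

definition sparse3_init :: "'a set \<Rightarrow> 'a set set \<Rightarrow> 'a sparse3_state" where
  "sparse3_init V E = Loop V E {}"

end

theory Submission imports Defs begin

text \<open>Each removal of a vertex of degree at least 4 lowers \<open>2 * |V| + |E|\<close> by at least 6, and the
  final cover obeys \<open>min (|V| / 2) (|E| / 2) \<le> (2 * |V| + |E|) / 6\<close>, the right-hand side being a
  convex combination of the two bounds. A run cannot get stuck because a graph of maximum degree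
  at most 3 has a cover within the required bound. Greedily removing vertices of
  degree at least 2 gives a cover of size at most \<open>|E| / 2\<close>; and in a bipartition of the vertices
  with the fewest monochromatic edges every vertex has at most one neighbour on its own side, so
  each of the two sides is a cover, and the smaller one has size at most \<open>|V| / 2\<close>.\<close>

section \<open>Vertex deletion and paths on three vertices\<close>

lemma simple_graph_finite_edges:
  assumes "simple_graph V E"
  shows "finite E"
proof (rule finite_subset)
  show "E \<subseteq> Pow V" using assms by (auto simp: simple_graph_def)
  show "finite (Pow V)" using assms by (simp add: simple_graph_def)
qed

lemma simple_graph_delete_vertex:
  assumes "simple_graph V E"
  shows "simple_graph (V - {v}) {e \<in> E. v \<notin> e}"
  using assms unfolding simple_graph_def by auto

text \<open>The additive form avoids truncated subtraction on \<open>nat\<close>. The lemma is used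
  for \<open>E\<close> and also for \<open>mono_edges E A\<close> in place of
  \<open>E\<close>.\<close>

lemma card_edges_delete_vertex:
  assumes "finite E"
  shows "card {e \<in> E. v \<notin> e} + degree E v = card E"
proof -
  have "card ({e \<in> E. v \<notin> e} \<union> {e \<in> E. v \<in> e}) = card {e \<in> E. v \<notin> e} + card {e \<in> E. v \<in> e}"
    using assms by (intro card_Un_disjoint) auto
  moreover have "{e \<in> E. v \<notin> e} \<union> {e \<in> E. v \<in> e} = E" by auto
  ultimately show ?thesis by (simp add: degree_def)
qed

text \<open>Replaces lists by three named vertices, so that later arguments can refer to the middle
  vertex and the two edges at it.\<close>

lemma three_path_vertex_cover_iff:
  "three_path_vertex_cover V E S \<longleftrightarrow> S \<subseteq> V \<and>
     (\<forall>a b c. distinct [a, b, c] \<and> {a, b, c} \<subseteq> V \<and> {a, b} \<in> E \<and> {b, c} \<in> E \<longrightarrow>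
        a \<in> S \<or> b \<in> S \<or> c \<in> S)"
proof -
  have path: "is_path V E [a, b, c] \<longleftrightarrow>
      distinct [a, b, c] \<and> {a, b, c} \<subseteq> V \<and> {a, b} \<in> E \<and> {b, c} \<in> E" for a b c
    by (simp add: is_path_def less_Suc_eq all_conj_distrib)
  have len: "(\<forall>p. length p = 3 \<longrightarrow> P p) \<longleftrightarrow> (\<forall>a b c. P [a, b, c])" for P :: "'a list \<Rightarrow> bool"
    by (auto simp: numeral_3_eq_3 length_Suc_conv)
  have "(\<forall>p. is_path V E p \<and> length p = 3 \<longrightarrow> set p \<inter> S \<noteq> {}) \<longleftrightarrow>
        (\<forall>p. length p = 3 \<longrightarrow> is_path V E p \<longrightarrow> set p \<inter> S \<noteq> {})" by blast
  also have "\<dots> \<longleftrightarrow> (\<forall>a b c. is_path V E [a, b, c] \<longrightarrow> set [a, b, c] \<inter> S \<noteq> {})"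
    by (rule len)
  also have "\<dots> \<longleftrightarrow> (\<forall>a b c. is_path V E [a, b, c] \<longrightarrow> a \<in> S \<or> b \<in> S \<or> c \<in> S)"
    by auto
  finally show ?thesis
    unfolding three_path_vertex_cover_def path by simp
qed

text \<open>A 3-path avoiding \<open>v\<close> uses no edge at \<open>v\<close>, so it survives the
  deletion and meets \<open>S\<close>. This serves both the greedy cover and the loop of the
  algorithm.\<close>

lemma three_path_vertex_cover_insert:
  assumes "v \<in> V" "three_path_vertex_cover (V - {v}) {e \<in> E. v \<notin> e} S"
  shows "three_path_vertex_cover V E (insert v S)"
proof -
  have S: "S \<subseteq> V - {v}"
    and cov: "\<And>a b c. \<lbrakk>distinct [a, b, c]; {a, b, c} \<subseteq> V - {v};
        {a, b} \<in> {e \<in> E. v \<notin> e}; {b, c} \<in> {e \<in> E. v \<notin> e}\<rbrakk> \<Longrightarrow> a \<in> S \<or> b \<in> S \<or> c \<in> S"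
    using assms(2) unfolding three_path_vertex_cover_iff by blast+
  have "a \<in> insert v S \<or> b \<in> insert v S \<or> c \<in> insert v S"
    if "distinct [a, b, c]" "{a, b, c} \<subseteq> V" "{a, b} \<in> E" "{b, c} \<in> E" for a b c
    using cov[of a b c] that by auto
  with S assms(1) show ?thesis unfolding three_path_vertex_cover_iff by blast
qed

section \<open>Existence of a cover for the final step\<close>

text \<open>Each chosen vertex is paid for by the at least two edges that vanish with it. Once all
  degrees are at most 1, no vertex can be the middle of a 3-path, and the empty set is a
  cover.\<close>

lemma ex_three_path_vertex_cover_edges:
  assumes "simple_graph V E"
  shows "\<exists>S. three_path_vertex_cover V E S \<and> 2 * card S \<le> card E"
  using assms
proof (induction "card V" arbitrary: V E rule: less_induct)
  case less
  note E = simple_graph_finite_edges[OF less.prems]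
  show ?case
  proof (cases "\<exists>v\<in>V. degree E v \<ge> 2")
    case True
    then obtain v where v: "v \<in> V" "degree E v \<ge> 2" by blast
    have "card (V - {v}) < card V"
      using less.prems v(1) by (intro card_Diff1_less) (auto simp: simple_graph_def)
    from less.hyps[OF this simple_graph_delete_vertex[OF less.prems]] obtain S
      where S: "three_path_vertex_cover (V - {v}) {e \<in> E. v \<notin> e} S"
        "2 * card S \<le> card {e \<in> E. v \<notin> e}" by blast
    have "2 * card (insert v S) \<le> card E"
      using S(2) v(2) card_edges_delete_vertex[OF E, of v] card_insert_le_m1[of "Suc (card S)" S v]
      by simp
    with three_path_vertex_cover_insert[OF v(1) S(1)] show ?thesis by blast
  next
    case False
    have "\<not> (distinct [a, b, c] \<and> {a, b, c} \<subseteq> V \<and> {a, b} \<in> E \<and> {b, c} \<in> E)" for a b c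
    proof
      assume *: "distinct [a, b, c] \<and> {a, b, c} \<subseteq> V \<and> {a, b} \<in> E \<and> {b, c} \<in> E"
      have "card {{a, b}, {b, c}} \<le> degree E b"
        unfolding degree_def using * E by (intro card_mono) auto
      moreover have "{a, b} \<noteq> {b, c}" using * by (auto simp: doubleton_eq_iff)
      ultimately show False using False * by auto
    qed
    then have "three_path_vertex_cover V E {}" unfolding three_path_vertex_cover_iff by blast
    then show ?thesis by (intro exI[of _ "{}"]) simp
  qed
qed

text \<open>The monochromatic edges of the bipartition into \<open>A\<close> and its complement.
  Disjointness from \<open>A\<close> expresses lying in the other side without mentioning
  \<open>V\<close>.\<close>

definition mono_edges :: "'a set set \<Rightarrow> 'a set \<Rightarrow> 'a set set" where
  "mono_edges E A = {e \<in> E. e \<subseteq> A \<or> e \<inter> A = {}}"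

text \<open>Local optimality of a maximum cut: moving \<open>v\<close> to the other side exchanges
  its monochromatic and its cut edges and affects no other edge, so by minimality the former cannot
  outnumber the latter.\<close>

lemma ex_balanced_bipartition:
  assumes "simple_graph V E"
  obtains A where "A \<subseteq> V" "\<And>v. v \<in> V \<Longrightarrow> 2 * card {e \<in> mono_edges E A. v \<in> e} \<le> degree E v"
proof -
  note E = simple_graph_finite_edges[OF assms]
  \<comment> \<open>The counts attained by subsets of \<open>V\<close> include that of
    \<open>{}\<close>, so there is a least one.\<close>
  obtain A where A: "A \<subseteq> V"
    and min: "\<And>B. B \<subseteq> V \<Longrightarrow> card (mono_edges E A) \<le> card (mono_edges E B)"
    using exists_least_iff[of "\<lambda>k. \<exists>A\<subseteq>V. card (mono_edges E A) = k"]
    by (metis empty_subsetI not_less)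
  have "2 * card {e \<in> mono_edges E A. v \<in> e} \<le> degree E v" if v: "v \<in> V" for v
  proof -
    define B where "B = (if v \<in> A then A - {v} else insert v A)"
    let ?keep = "{e \<in> mono_edges E A. v \<notin> e}"
    let ?mono = "{e \<in> mono_edges E A. v \<in> e}"
    let ?cut = "{e \<in> E. v \<in> e} - mono_edges E A"
    have fin: "finite (mono_edges E A)" using E by (simp add: mono_edges_def)
    \<comment> \<open>The other end \<open>w\<close> of the edge stays on its side while
      \<open>v\<close> moves.\<close>
    have flip: "e \<in> mono_edges E B \<longleftrightarrow> e \<notin> mono_edges E A" if e: "e \<in> E" "v \<in> e" for e
    proof -
      have "card e = 2" using assms e by (auto simp: simple_graph_def)
      then obtain w where w: "e = {v, w}" "w \<noteq> v"
        using e(2) by (auto simp: card_2_iff)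
      show ?thesis using e(1) w by (auto simp: mono_edges_def B_def)
    qed
    have "e \<in> mono_edges E B \<longleftrightarrow> e \<in> mono_edges E A" if "v \<notin> e" for e
      using that by (auto simp: mono_edges_def B_def)
    with flip have "mono_edges E B = ?keep \<union> ?cut"
      by (auto simp: mono_edges_def)
    moreover have "card (?keep \<union> ?cut) = card ?keep + card ?cut"
      using E fin by (intro card_Un_disjoint) auto
    moreover have "card (mono_edges E A) = card ?keep + card ?mono"
      using card_edges_delete_vertex[OF fin, of v] by (simp add: degree_def)
    moreover have "card (mono_edges E A) \<le> card (mono_edges E B)"
      using A v by (intro min) (auto simp: B_def)
    moreover have "degree E v = card ?mono + card ?cut"
    proof -
      have "{e \<in> E. v \<in> e} = ?mono \<union> ?cut" by (auto simp: mono_edges_def)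
      moreover have "card (?mono \<union> ?cut) = card ?mono + card ?cut"
        using E fin by (intro card_Un_disjoint) auto
      ultimately show ?thesis by (simp add: degree_def)
    qed
    ultimately show ?thesis by simp
  qed
  with A show ?thesis by (rule that)
qed

text \<open>Twice the number of monochromatic edges at a vertex is at most 3, so there is at most
  one. A 3-path missing one side lies wholly in the other and would have two such edges at its
  middle vertex.\<close>

lemma ex_three_path_vertex_cover_vertices:
  assumes G: "simple_graph V E" and deg: "\<forall>v\<in>V. degree E v \<le> 3"
  shows "\<exists>S. three_path_vertex_cover V E S \<and> 2 * card S \<le> card V"
proof -
  obtain A where A: "A \<subseteq> V"
    and bal: "\<And>v. v \<in> V \<Longrightarrow> 2 * card {e \<in> mono_edges E A. v \<in> e} \<le> degree E v"
    using ex_balanced_bipartition[OF G] by blast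
  have fin: "finite (mono_edges E A)"
    using simple_graph_finite_edges[OF G] by (simp add: mono_edges_def)
  have split: "\<not> ({a, b} \<in> mono_edges E A \<and> {b, c} \<in> mono_edges E A)"
    if "distinct [a, b, c]" "b \<in> V" for a b c
  proof
    assume *: "{a, b} \<in> mono_edges E A \<and> {b, c} \<in> mono_edges E A"
    have "card {{a, b}, {b, c}} \<le> card {e \<in> mono_edges E A. b \<in> e}"
      using * fin by (intro card_mono) auto
    moreover have "{a, b} \<noteq> {b, c}" using that(1) by (auto simp: doubleton_eq_iff)
    ultimately have "4 \<le> 2 * card {e \<in> mono_edges E A. b \<in> e}" by simp
    with bal[OF that(2)] deg that(2) show False by fastforce
  qed
  have cover: "three_path_vertex_cover V E S" if S: "S = A \<or> S = V - A" for S
    unfolding three_path_vertex_cover_iff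
  proof (intro conjI allI impI)
    show "S \<subseteq> V" using S A by auto
    fix a b c
    assume *: "distinct [a, b, c] \<and> {a, b, c} \<subseteq> V \<and> {a, b} \<in> E \<and> {b, c} \<in> E"
    show "a \<in> S \<or> b \<in> S \<or> c \<in> S"
    proof (rule ccontr)
      assume "\<not> (a \<in> S \<or> b \<in> S \<or> c \<in> S)"
      with * S have "{a, b} \<in> mono_edges E A \<and> {b, c} \<in> mono_edges E A"
        by (auto simp: mono_edges_def)
      with split[of a b c] * show False by simp
    qed
  qed
  have "card A + card (V - A) = card V"
    using G A by (metis card_Diff_subset card_mono finite_subset le_add_diff_inverse simple_graph_def)
  then have "2 * card A \<le> card V \<or> 2 * card (V - A) \<le> card V" by linarith
  with cover show ?thesis by blast
qed

text \<open>The final step needs one set obeying both bounds; the smaller of the two covers inherits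
  both.\<close>

lemma ex_small_three_path_vertex_cover:
  assumes "simple_graph V E" "\<forall>v\<in>V. degree E v \<le> 3"
  shows "\<exists>S. three_path_vertex_cover V E S \<and>
           real (card S) \<le> min (real (card V) / 2) (real (card E) / 2)"
proof -
  obtain S T where S: "three_path_vertex_cover V E S" "2 * card S \<le> card V"
    and T: "three_path_vertex_cover V E T" "2 * card T \<le> card E"
    using ex_three_path_vertex_cover_vertices[OF assms]
      ex_three_path_vertex_cover_edges[OF assms(1)] by blast
  show ?thesis
  proof (cases "card S \<le> card T")
    case True
    with S T show ?thesis by (intro exI[of _ S]) auto
  next
    case False
    with S T show ?thesis by (intro exI[of _ T]) auto
  qed
qed

section \<open>Invariant, termination and progress of the runs\<close>

text \<open>Quantifying over every cover \<open>S\<close> of the current graph leaves the choice in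
  the final step open. The size clause says that the potential 6|H| + 2|V| + |E| never exceeds its
  initial value.\<close>

fun sparse3_invariant :: "'a set \<Rightarrow> 'a set set \<Rightarrow> 'a sparse3_state \<Rightarrow> bool" where
  "sparse3_invariant V\<^sub>0 E\<^sub>0 (Loop V E H) \<longleftrightarrow>
     simple_graph V E \<and>
     (\<forall>S. three_path_vertex_cover V E S \<longrightarrow> three_path_vertex_cover V\<^sub>0 E\<^sub>0 (H \<union> S)) \<and>
     6 * card H + 2 * card V + card E \<le> 2 * card V\<^sub>0 + card E\<^sub>0"
| "sparse3_invariant V\<^sub>0 E\<^sub>0 (Returned H) \<longleftrightarrow>
     three_path_vertex_cover V\<^sub>0 E\<^sub>0 H \<and> 6 * card H \<le> 2 * card V\<^sub>0 + card E\<^sub>0"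

text \<open>\<open>Suc\<close> keeps a \<open>Loop\<close> state with no vertices strictly above
  \<open>Returned\<close>.\<close>

fun sparse3_measure :: "'a sparse3_state \<Rightarrow> nat" where
  "sparse3_measure (Loop V E H) = Suc (card V)"
| "sparse3_measure (Returned H) = 0"

lemma sparse3_step_invariant:
  assumes "sparse3_step s t" "sparse3_invariant V\<^sub>0 E\<^sub>0 s"
  shows "sparse3_invariant V\<^sub>0 E\<^sub>0 t \<and> sparse3_measure t < sparse3_measure s"
  using assms
proof cases
  case (remove v V E H)
  then have G: "simple_graph V E"
    and lift: "\<And>S. three_path_vertex_cover V E S \<Longrightarrow> three_path_vertex_cover V\<^sub>0 E\<^sub>0 (H \<union> S)"
    and size: "6 * card H + 2 * card V + card E \<le> 2 * card V\<^sub>0 + card E\<^sub>0"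
    using assms(2) by auto
  have V: "Suc (card (V - {v})) = card V"
    using G remove(3) by (intro card_Suc_Diff1) (auto simp: simple_graph_def)
  have "three_path_vertex_cover V\<^sub>0 E\<^sub>0 (insert v H \<union> S)"
    if "three_path_vertex_cover (V - {v}) {e \<in> E. v \<notin> e} S" for S
    using lift[OF three_path_vertex_cover_insert[OF remove(3) that]] by simp
  \<comment> \<open>The potential gains at most 6 here and loses 2 for the vertex and at least 4 for
    its edges.\<close>
  moreover have "card (insert v H) \<le> Suc (card H)"
    by (rule card_insert_le_m1) simp_all
  ultimately show ?thesis
    using V size remove(4) simple_graph_delete_vertex[OF G, of v]
      card_edges_delete_vertex[OF simple_graph_finite_edges[OF G], of v]
    unfolding remove(1,2) by simp
next
  case (finish V E S H)
  with assms(2) have "three_path_vertex_cover V\<^sub>0 E\<^sub>0 (H \<union> S)" by simp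
  moreover have "card (H \<union> S) \<le> card H + card S" by (rule card_Un_le)
  \<comment> \<open>Add 4|S| \<le> 2|V| and 2|S| \<le> |E|, one from each half of the
    minimum.\<close>
  moreover have "6 * card S \<le> 2 * card V + card E"
    using finish(5) by simp
  ultimately show ?thesis using assms(2) unfolding finish(1,2) by simp
qed

lemma sparse3_invariant_init:
  assumes "simple_graph V E"
  shows "sparse3_invariant V E (sparse3_init V E)"
  using assms by (simp add: sparse3_init_def)

theorem theorem7:
  fixes V :: "'a set" and E :: "'a set set"
  assumes "simple_graph V E"
  shows "\<not> (\<exists>run :: nat \<Rightarrow> 'a sparse3_state.
           run 0 = sparse3_init V E \<and> (\<forall>i. sparse3_step (run i) (run (Suc i))))
       \<and> (\<forall>s. sparse3_step\<^sup>*\<^sup>* (sparse3_init V E) s \<and> \<not> (\<exists>t. sparse3_step s t) \<longrightarrow>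
           (\<exists>H. s = Returned H \<and> three_path_vertex_cover V E H \<and>
                real (card H) \<le> (2 * real (card V) + real (card E)) / 6))"
proof (intro conjI allI impI notI)
  assume "\<exists>run. run 0 = sparse3_init V E \<and> (\<forall>i. sparse3_step (run i) (run (Suc i)))"
  then obtain run where run: "run 0 = sparse3_init V E"
    "\<And>i. sparse3_step (run i) (run (Suc i))" by blast
  have inv: "sparse3_invariant V E (run i)" for i
  proof (induction i)
    case 0
    show ?case using sparse3_invariant_init[OF assms] run(1) by simp
  next
    case (Suc i)
    then show ?case using sparse3_step_invariant[OF run(2)] by blast
  qed
  have "sparse3_measure (run (Suc i)) < sparse3_measure (run i)" for i
    using sparse3_step_invariant[OF run(2) inv] by blast
  then show False
    using wf_no_infinite_down_chainE[OF wf_measure[of sparse3_measure], of run] by auto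
next
  fix s
  assume s: "sparse3_step\<^sup>*\<^sup>* (sparse3_init V E) s \<and> \<not> (\<exists>t. sparse3_step s t)"
  then have "sparse3_step\<^sup>*\<^sup>* (sparse3_init V E) s" ..
  then have inv: "sparse3_invariant V E s"
    by induction (use sparse3_invariant_init[OF assms] sparse3_step_invariant in blast)+
  show "\<exists>H. s = Returned H \<and> three_path_vertex_cover V E H \<and>
      real (card H) \<le> (2 * real (card V) + real (card E)) / 6"
  proof (cases s)
    case (Loop V' E' H)
    \<comment> \<open>A \<open>Loop\<close> state always has a successor, so a halted run has
      returned. The invariant supplies that the current graph is simple, as the existence of the
      final cover requires.\<close>
    have "\<exists>t. sparse3_step s t"
    proof (cases "\<exists>v\<in>V'. degree E' v \<ge> 4")
      case True
      then show ?thesis unfolding Loop by (blast intro: sparse3_step.remove)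
    next
      case False
      then have deg: "\<forall>v\<in>V'. degree E' v \<le> 3" by force
      have "simple_graph V' E'" using inv Loop by simp
      from ex_small_three_path_vertex_cover[OF this deg] deg show ?thesis
        unfolding Loop by (blast intro: sparse3_step.finish)
    qed
    with s show ?thesis by blast
  next
    case (Returned H)
    with inv show ?thesis by auto
  qed
qed

end
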